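(* Let $G$ be a compact Lie group and let $X$ be a $G$-connected $G$-space with $X^G\neq\varnothing$. Let $x_0\in X^G$ and define $G$-maps $i_1,i_2\colon X\to X\times X$ (with diagonal action on $X\times X$) by $i_1(x)=(x,x_0)$ and $i_2(x)=(x_0,x)$. Then $$\mathrm{cat}_G(X)=D_G(i_1,i_2).$$
   Context: $\simeq_G$ denotes $G$-homotopy. For a closed subgroup $H\le G$, $X^H=\{x\in X\mid hx=x \text{ for all } h\in H\}$. A $G$-space $X$ is $G$-connected if $X^H$ is path-connected for every closed subgroup $H$ of $G$. Equivariant LS category: a $G$-invariant open subset $U\subseteq X$ is $G$-categorical if the inclusion $U\hookrightarrow X$ is $G$-homotopic to a $G$-map whose image lies in a single orbit. $\mathrm{cat}_G(X)$ is the least integer $n\ge0$ such that $X$ can be covered by $n+1$ $G$-categorical sets ($\infty$ if none exists). Equivariant homotopic distance: for $G$-maps $f,g\colon X\to Y$, $D_G(f,g)$ is the least integer $n\ge 0$ such that $X$ has an open cover $\{U_0,\dots,U_n\}$ by $G$-invariant open sets with $f|_{U_i}\simeq_G g|_{U_i}$ for all $0\le i\le n$; it is $\infty$ if no such $n$ exists.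
   Formalization: The space X is additionally assumed to be T0 (weaker than the usual Hausdorff convention for G-spaces); with no separation axiom at all the equality can fail, for example for a circle action with an indiscrete free orbit. *)

theory Defs
  imports "HOL-Analysis.Analysis" "HOL-Algebra.Group_Action"
begin

section \<open>Smooth manifolds and Lie groups\<close>

text \<open>
  Manifolds of dimension \<open>n\<close> are modelled on the library's \<open>Euclidean_space n\<close>, the topology on
  \<open>{x :: nat \<Rightarrow> real. \<forall>i\<ge>n. x i = 0}\<close>, so that every dimension is covered, including \<open>n = 0\<close>
  (finite groups are compact Lie groups).

  \<open>Ck_on n k W f\<close>: all iterated partial derivatives of \<open>f\<close> up to order \<open>k\<close> exist and are continuous
  on \<open>W\<close>.  It is only meant for \<open>W\<close> open in \<open>Euclidean_space n\<close>; the values of \<open>f\<close> outside \<open>W\<close> are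
  then irrelevant.
\<close>

primrec Ck_on :: "nat \<Rightarrow> nat \<Rightarrow> (nat \<Rightarrow> real) set \<Rightarrow> ((nat \<Rightarrow> real) \<Rightarrow> real) \<Rightarrow> bool" where
  "Ck_on n 0 W f \<longleftrightarrow> continuous_map (subtopology (Euclidean_space n) W) euclideanreal f"
| "Ck_on n (Suc k) W f \<longleftrightarrow>
     continuous_map (subtopology (Euclidean_space n) W) euclideanreal f \<and>
     (\<forall>i<n. \<exists>f'. (\<forall>x\<in>W. ((\<lambda>s. f (x(i := s))) has_real_derivative f' x) (at (x i))) \<and>
                  Ck_on n k W f')"

definition smooth_map_on ::
    "nat \<Rightarrow> nat \<Rightarrow> (nat \<Rightarrow> real) set \<Rightarrow> ((nat \<Rightarrow> real) \<Rightarrow> (nat \<Rightarrow> real)) \<Rightarrow> bool" where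
  "smooth_map_on n m W F \<longleftrightarrow> (\<forall>k. \<forall>j<m. Ck_on n k W (\<lambda>x. F x j))"

text \<open>A chart is a pair of its domain and its coordinate map; an atlas is a set of charts.\<close>

type_synonym 'a chart = "'a set \<times> ('a \<Rightarrow> (nat \<Rightarrow> real))"

definition smooth_atlas :: "nat \<Rightarrow> 'a topology \<Rightarrow> 'a chart set \<Rightarrow> bool" where
  "smooth_atlas n T A \<longleftrightarrow>
     (\<forall>(U, c) \<in> A. openin T U \<and> openin (Euclidean_space n) (c ` U) \<and>
        homeomorphic_map (subtopology T U) (subtopology (Euclidean_space n) (c ` U)) c) \<and>
     (\<Union>(U, c) \<in> A. U) = topspace T \<and>
     (\<forall>(U, c) \<in> A. \<forall>(V, d) \<in> A. smooth_map_on n n (c ` (U \<inter> V)) (\<lambda>z. d (inv_into U c z)))"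

definition smooth_manifold :: "nat \<Rightarrow> 'a topology \<Rightarrow> 'a chart set \<Rightarrow> bool" where
  "smooth_manifold n T A \<longleftrightarrow> Hausdorff_space T \<and> second_countable T \<and> smooth_atlas n T A"

definition smooth_manifold_map ::
    "nat \<Rightarrow> 'a topology \<Rightarrow> 'a chart set \<Rightarrow> nat \<Rightarrow> 'b topology \<Rightarrow> 'b chart set \<Rightarrow> ('a \<Rightarrow> 'b) \<Rightarrow> bool" where
  "smooth_manifold_map n T A m T' B F \<longleftrightarrow>
     continuous_map T T' F \<and>
     (\<forall>(U, c) \<in> A. \<forall>(V, d) \<in> B.
        smooth_map_on n m (c ` {x \<in> U. F x \<in> V}) (\<lambda>z. d (F (inv_into U c z))))"

text \<open>
  The product chart concatenates coordinates.  As coordinates of an \<open>m\<close>-dimensional chart vanish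
  from index \<open>m\<close> on, it takes values in \<open>Euclidean_space (n + m)\<close>.
\<close>

definition prod_atlas :: "nat \<Rightarrow> 'a chart set \<Rightarrow> 'b chart set \<Rightarrow> ('a \<times> 'b) chart set" where
  "prod_atlas n A B =
     {(U \<times> V, \<lambda>(x, y) i. if i < n then c x i else d y (i - n)) | U c V d. (U, c) \<in> A \<and> (V, d) \<in> B}"

definition Lie_group ::
    "('g, 'm) monoid_scheme \<Rightarrow> 'g topology \<Rightarrow> nat \<Rightarrow> 'g chart set \<Rightarrow> bool" where
  "Lie_group G T n A \<longleftrightarrow>
     group G \<and> topspace T = carrier G \<and> smooth_manifold n T A \<and>
     smooth_manifold_map (n + n) (prod_topology T T) (prod_atlas n A A) n T A
       (\<lambda>(g, h). g \<otimes>\<^bsub>G\<^esub> h) \<and>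
     smooth_manifold_map n T A n T A (\<lambda>g. inv\<^bsub>G\<^esub> g)"

definition compact_Lie_group ::
    "('g, 'm) monoid_scheme \<Rightarrow> 'g topology \<Rightarrow> nat \<Rightarrow> 'g chart set \<Rightarrow> bool" where
  "compact_Lie_group G T n A \<longleftrightarrow> Lie_group G T n A \<and> compact_space T"


section \<open>\<open>G\<close>-spaces\<close>

definition G_space ::
    "('g, 'm) monoid_scheme \<Rightarrow> 'g topology \<Rightarrow> 'x topology \<Rightarrow> ('g \<Rightarrow> 'x \<Rightarrow> 'x) \<Rightarrow> bool" where
  "G_space G T X \<phi> \<longleftrightarrow>
     group_action G (topspace X) \<phi> \<and>
     continuous_map (prod_topology T X) X (\<lambda>(g, x). \<phi> g x)"

text \<open>
  The theory of orbits needs a separation axiom, which is usually part of the definition of a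
  \<open>G\<close>-space (Hausdorff, or weak Hausdorff).  \<open>T\<^sub>0\<close> is implied by these conventions, and it suffices:
  for a compact group it already makes stabilisers closed and each orbit homeomorphic to the
  quotient of the group by a stabiliser.
\<close>

definition T0_space :: "'x topology \<Rightarrow> bool" where
  "T0_space X \<longleftrightarrow>
     (\<forall>x \<in> topspace X. \<forall>y \<in> topspace X. x \<noteq> y \<longrightarrow> (\<exists>U. openin X U \<and> (x \<in> U) \<noteq> (y \<in> U)))"

definition fixed_points :: "'x topology \<Rightarrow> ('g \<Rightarrow> 'x \<Rightarrow> 'x) \<Rightarrow> 'g set \<Rightarrow> 'x set" where
  "fixed_points X \<phi> H = {x \<in> topspace X. \<forall>h \<in> H. \<phi> h x = x}"

definition G_connected ::
    "('g, 'm) monoid_scheme \<Rightarrow> 'g topology \<Rightarrow> 'x topology \<Rightarrow> ('g \<Rightarrow> 'x \<Rightarrow> 'x) \<Rightarrow> bool" where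
  "G_connected G T X \<phi> \<longleftrightarrow>
     (\<forall>H. subgroup H G \<and> closedin T H \<longrightarrow> path_connectedin X (fixed_points X \<phi> H))"

text \<open>
  The restriction to \<open>topspace X \<times> topspace X\<close> is needed because \<open>group_action\<close> requires the
  acting maps to be extensional.
\<close>

definition diagonal_action ::
    "'x topology \<Rightarrow> ('g \<Rightarrow> 'x \<Rightarrow> 'x) \<Rightarrow> 'g \<Rightarrow> 'x \<times> 'x \<Rightarrow> 'x \<times> 'x" where
  "diagonal_action X \<phi> g = (\<lambda>p \<in> topspace X \<times> topspace X. (\<phi> g (fst p), \<phi> g (snd p)))"

definition G_invariant ::
    "('g, 'm) monoid_scheme \<Rightarrow> ('g \<Rightarrow> 'x \<Rightarrow> 'x) \<Rightarrow> 'x set \<Rightarrow> bool" where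
  "G_invariant G \<phi> U \<longleftrightarrow> (\<forall>g \<in> carrier G. \<forall>x \<in> U. \<phi> g x \<in> U)"

definition G_equivariant ::
    "('g, 'm) monoid_scheme \<Rightarrow> 'x set \<Rightarrow> ('g \<Rightarrow> 'x \<Rightarrow> 'x) \<Rightarrow> ('g \<Rightarrow> 'y \<Rightarrow> 'y) \<Rightarrow> ('x \<Rightarrow> 'y) \<Rightarrow> bool" where
  "G_equivariant G S \<phi> \<psi> f \<longleftrightarrow> (\<forall>g \<in> carrier G. \<forall>x \<in> S. f (\<phi> g x) = \<psi> g (f x))"

definition G_map ::
    "('g, 'm) monoid_scheme \<Rightarrow> 'x topology \<Rightarrow> ('g \<Rightarrow> 'x \<Rightarrow> 'x) \<Rightarrow>
     'y topology \<Rightarrow> ('g \<Rightarrow> 'y \<Rightarrow> 'y) \<Rightarrow> ('x \<Rightarrow> 'y) \<Rightarrow> bool" where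
  "G_map G X \<phi> Y \<psi> f \<longleftrightarrow> continuous_map X Y f \<and> G_equivariant G (topspace X) \<phi> \<psi> f"

text \<open>
  A \<open>G\<close>-homotopy is a homotopy through equivariant maps, i.e. a \<open>G\<close>-map \<open>[0,1] \<times> X \<rightarrow> Y\<close> for the
  trivial action on \<open>[0,1]\<close>.
\<close>

definition G_homotopic ::
    "('g, 'm) monoid_scheme \<Rightarrow> 'x topology \<Rightarrow> ('g \<Rightarrow> 'x \<Rightarrow> 'x) \<Rightarrow>
     'y topology \<Rightarrow> ('g \<Rightarrow> 'y \<Rightarrow> 'y) \<Rightarrow> ('x \<Rightarrow> 'y) \<Rightarrow> ('x \<Rightarrow> 'y) \<Rightarrow> bool" where
  "G_homotopic G X \<phi> Y \<psi> f g \<longleftrightarrow>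
     homotopic_with (G_equivariant G (topspace X) \<phi> \<psi>) X Y f g"


section \<open>Equivariant LS category and equivariant homotopic distance\<close>

definition G_categorical ::
    "('g, 'm) monoid_scheme \<Rightarrow> 'x topology \<Rightarrow> ('g \<Rightarrow> 'x \<Rightarrow> 'x) \<Rightarrow> 'x set \<Rightarrow> bool" where
  "G_categorical G X \<phi> U \<longleftrightarrow>
     openin X U \<and> G_invariant G \<phi> U \<and>
     (\<exists>c. G_map G (subtopology X U) \<phi> X \<phi> c \<and>
          (\<exists>z \<in> topspace X. c ` U \<subseteq> orbit G \<phi> z) \<and>
          G_homotopic G (subtopology X U) \<phi> X \<phi> (\<lambda>x. x) c)"

text \<open>In \<open>enat\<close> the infimum of the empty set is \<open>\<infinity>\<close>, and that of a nonempty set is its least element.\<close>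

definition cat_G ::
    "('g, 'm) monoid_scheme \<Rightarrow> 'x topology \<Rightarrow> ('g \<Rightarrow> 'x \<Rightarrow> 'x) \<Rightarrow> enat" where
  "cat_G G X \<phi> =
     Inf {enat n | n. \<exists>U :: nat \<Rightarrow> 'x set.
            (\<forall>i\<le>n. G_categorical G X \<phi> (U i)) \<and> (\<Union>i\<le>n. U i) = topspace X}"

definition D_G ::
    "('g, 'm) monoid_scheme \<Rightarrow> 'x topology \<Rightarrow> ('g \<Rightarrow> 'x \<Rightarrow> 'x) \<Rightarrow>
     'y topology \<Rightarrow> ('g \<Rightarrow> 'y \<Rightarrow> 'y) \<Rightarrow> ('x \<Rightarrow> 'y) \<Rightarrow> ('x \<Rightarrow> 'y) \<Rightarrow> enat" where
  "D_G G X \<phi> Y \<psi> f g =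
     Inf {enat n | n. \<exists>U :: nat \<Rightarrow> 'x set.
            (\<forall>i\<le>n. openin X (U i) \<and> G_invariant G \<phi> (U i) \<and>
                   G_homotopic G (subtopology X (U i)) \<phi> Y \<psi> f g) \<and>
            (\<Union>i\<le>n. U i) = topspace X}"

end

theory Submission
  imports Defs
begin

text \<open>
  Over each invariant open set \<open>U\<close>, three conditions turn out to be equivalent: \<open>U\<close> is
  \<open>G\<close>-categorical; the inclusion of \<open>U\<close> is \<open>G\<close>-homotopic to the constant map at \<open>x\<^sub>0\<close>; and
  \<open>i\<^sub>1\<close> and \<open>i\<^sub>2\<close> are \<open>G\<close>-homotopic on \<open>U\<close>.  Hence the two numbers are infima over the same covers.

  Between the last two conditions one passes by \<open>(x, x\<^sub>0) \<simeq> (x\<^sub>0, x\<^sub>0) \<simeq> (x\<^sub>0, x)\<close> in one direction and by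
  projecting to the first factor in the other.  Between the first two, the orbit of \<open>x\<^sub>0\<close> is a point,
  so a deformation to \<open>x\<^sub>0\<close> is a deformation into an orbit.  For the converse it is enough to show that
  every orbit can be deformed equivariantly to \<open>x\<^sub>0\<close> inside \<open>X\<close> (\<open>orbit_G_contractible\<close>).
  Let \<open>H\<close> be the stabiliser of \<open>z\<close>.  Both \<open>z\<close> and \<open>x\<^sub>0\<close> are fixed by \<open>H\<close>, so there is a path \<open>\<alpha>\<close>
  in \<open>X\<^sup>H\<close> from \<open>z\<close> to \<open>x\<^sub>0\<close>, and \<open>(g z, t) \<mapsto> g \<alpha>(t)\<close> is a well-defined equivariant deformation.

  What this requires is topological: \<open>H\<close> must be closed, so that \<open>X\<^sup>H\<close> is path-connected, and
  \<open>G \<rightarrow> G z\<close> must be a quotient map, so that the deformation is continuous.  Both would be standard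
  for Hausdorff spaces.  For \<open>T\<^sub>0\<close> spaces they follow from the fact that points of an orbit are closed
  in it (\<open>closedin_orbit_singleton\<close>): the orbit is compact and \<open>T\<^sub>0\<close>, so it has at least one
  closed point, and all its points look alike.
\<close>

section \<open>Closed points of compact \<open>T\<^sub>0\<close> spaces\<close>

text \<open>
  By compactness a chain of proper open sets has a proper union, so Zorn's lemma provides a maximal
  proper open set.  Its complement is a minimal nonempty closed set, in which \<open>T\<^sub>0\<close> leaves room for
  one point only.
\<close>

lemma compact_T0_space_has_closed_point:
  assumes comp: "compact_space Y" and T0: "T0_space Y" and ne: "topspace Y \<noteq> {}"
  obtains y where "y \<in> topspace Y" "closedin Y {y}"
proof -
  let ?A = "{U. openin Y U \<and> U \<noteq> topspace Y}"
  have "\<exists>M\<in>?A. \<forall>U\<in>?A. M \<subseteq> U \<longrightarrow> U = M"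
  proof (rule subset_Zorn_nonempty)
    have "{} \<in> ?A"
      using ne by fastforce
    then show "?A \<noteq> {}"
      by blast
    fix \<C> assume "\<C> \<noteq> {}" and chain: "subset.chain ?A \<C>"
    then have sub: "\<C> \<subseteq> ?A"
      by (simp add: subset_chain_def)
    have "\<Union>\<C> \<noteq> topspace Y"
    proof
      assume "\<Union>\<C> = topspace Y"
      moreover have "\<forall>U\<in>\<C>. openin Y U"
        using sub by blast
      ultimately obtain \<F> where \<F>: "finite \<F>" "\<F> \<subseteq> \<C>" "\<Union>\<F> = topspace Y"
        using comp unfolding compact_space by meson
      moreover have "\<F> \<noteq> {}"
        using \<F>(3) ne by force
      moreover have "subset.chain ?A \<F>"
        using chain \<F>(2) unfolding subset_chain_def by (meson subset_iff)
      ultimately have "\<Union>\<F> \<in> \<F>"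
        using Union_in_chain by blast
      with \<F> sub show False
        by auto
    qed
    with sub show "\<Union>\<C> \<in> ?A"
      by auto
  qed
  then obtain M where M: "openin Y M" "M \<noteq> topspace Y"
    and max: "\<And>U. \<lbrakk>openin Y U; U \<noteq> topspace Y; M \<subseteq> U\<rbrakk> \<Longrightarrow> U = M"
    by blast
  then obtain y where y: "y \<in> topspace Y" "y \<notin> M"
    using openin_subset by blast
  have "x = y" if x: "x \<in> topspace Y" "x \<notin> M" for x
  proof (rule ccontr)
    assume "x \<noteq> y"
    then obtain U where U: "openin Y U" "(x \<in> U) \<noteq> (y \<in> U)"
      using T0 x y unfolding T0_space_def by blast
    with x y have "M \<union> U \<noteq> topspace Y" "M \<union> U \<noteq> M"
      by auto
    with max[of "M \<union> U"] M U show False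
      by auto
  qed
  then have "topspace Y - M = {y}"
    using y by blast
  with M y show ?thesis
    using that[of y] closedin_diff[OF closedin_topspace M(1)] by simp
qed


section \<open>Orbits of a compact group\<close>

locale compact_group_action = group_action G "topspace X" \<phi>
  for G (structure) and X :: "'x topology" and \<phi> :: "'g \<Rightarrow> 'x \<Rightarrow> 'x" +
  fixes T :: "'g topology"
  assumes topspace_group: "topspace T = carrier G"
    and compact_group: "compact_space T"
    and continuous_inv: "continuous_map T T (\<lambda>g. inv g)"
    and continuous_action: "continuous_map (prod_topology T X) X (\<lambda>(g, x). \<phi> g x)"
begin

lemma group_G: "group G"
  using group_hom group_hom.axioms(1) by blast

lemma continuous_map_act:
  assumes "continuous_map Z T a" "continuous_map Z X b"
  shows "continuous_map Z X (\<lambda>z. \<phi> (a z) (b z))"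
  using continuous_map_compose[OF continuous_map_pairedI[OF assms] continuous_action]
  by (simp add: o_def)

lemma continuous_map_act_left:
  assumes "g \<in> carrier G"
  shows "continuous_map X X (\<phi> g)"
  using continuous_map_act[of X "\<lambda>_. g" "\<lambda>x. x"] assms by (simp add: topspace_group)

lemma continuous_map_orbit_map:
  assumes "z \<in> topspace X"
  shows "continuous_map T X (\<lambda>g. \<phi> g z)"
  using continuous_map_act[of T "\<lambda>g. g" "\<lambda>_. z"] assms by simp

lemma act_in_topspace: "\<lbrakk>g \<in> carrier G; x \<in> topspace X\<rbrakk> \<Longrightarrow> \<phi> g x \<in> topspace X"
  using element_image by blast

lemma orbit_subset_topspace: "z \<in> topspace X \<Longrightarrow> orbit G \<phi> z \<subseteq> topspace X"
  by (auto simp: orbit_def act_in_topspace)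

lemma act_in_orbit:
  assumes "z \<in> topspace X" "g \<in> carrier G" "y \<in> orbit G \<phi> z"
  shows "\<phi> g y \<in> orbit G \<phi> z"
  using assms group.is_monoid[OF group_G]
  by (force simp: orbit_def composition_rule[symmetric] intro: monoid.m_closed)

text \<open>
  An orbit is compact, being an image of the group, and so has a closed point \<open>w z\<close>.  Acting by \<open>w\<close>
  is a continuous self-map of the orbit, under which the preimage of \<open>w z\<close> is the point \<open>z\<close>.
\<close>

lemma closedin_orbit_singleton:
  assumes T0: "T0_space X" and z: "z \<in> topspace X"
  shows "closedin (subtopology X (orbit G \<phi> z)) {z}"
proof -
  let ?O = "subtopology X (orbit G \<phi> z)"
  have top: "topspace ?O = orbit G \<phi> z"
    using orbit_subset_topspace[OF z] by auto
  have z_orb: "z \<in> orbit G \<phi> z"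
    using orbit_refl[OF z] .
  have "compactin X ((\<lambda>g. \<phi> g z) ` topspace T)"
    using image_compactin compact_group continuous_map_orbit_map[OF z]
    unfolding compact_space_def by blast
  moreover have "(\<lambda>g. \<phi> g z) ` topspace T = orbit G \<phi> z"
    by (auto simp: orbit_def topspace_group)
  ultimately have "compact_space ?O"
    by (simp add: compactin_subspace)
  moreover have "T0_space ?O"
    unfolding T0_space_def
  proof (intro ballI impI)
    fix x y assume xy: "x \<in> topspace ?O" "y \<in> topspace ?O" "x \<noteq> y"
    then obtain U where "openin X U" "(x \<in> U) \<noteq> (y \<in> U)"
      using T0 unfolding T0_space_def by auto
    with xy show "\<exists>U. openin ?O U \<and> (x \<in> U) \<noteq> (y \<in> U)"
      by (intro exI[of _ "orbit G \<phi> z \<inter> U"]) (auto simp: openin_subtopology_Int2)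
  qed
  moreover have "topspace ?O \<noteq> {}"
    using z_orb top by auto
  ultimately obtain y where y: "y \<in> topspace ?O" "closedin ?O {y}"
    using compact_T0_space_has_closed_point by blast
  then obtain w where w: "w \<in> carrier G" "y = \<phi> w z"
    using y(1)[unfolded top] unfolding orbit_def by blast
  have "continuous_map ?O ?O (\<phi> w)"
    using continuous_map_act_left[OF w(1)] act_in_orbit[OF z w(1)]
    by (auto simp: continuous_map_in_subtopology continuous_map_from_subtopology)
  then have "closedin ?O {x \<in> topspace ?O. \<phi> w x \<in> {y}}"
    using y(2) by (rule closedin_continuous_map_preimage)
  moreover have "{x \<in> topspace ?O. \<phi> w x \<in> {y}} = {z}"
    using z_orb orbit_subset_topspace[OF z] inj_onD[OF inj_prop[OF w(1)]] z w(2) top by auto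
  ultimately show ?thesis
    by simp
qed

lemma closedin_stabilizer:
  assumes "T0_space X" and z: "z \<in> topspace X"
  shows "closedin T (stabilizer G \<phi> z)"
proof -
  have "continuous_map T (subtopology X (orbit G \<phi> z)) (\<lambda>g. \<phi> g z)"
    using continuous_map_orbit_map[OF z]
    by (auto simp: continuous_map_in_subtopology orbit_def topspace_group)
  then have "closedin T {g \<in> topspace T. \<phi> g z \<in> {z}}"
    using closedin_orbit_singleton[OF assms] by (rule closedin_continuous_map_preimage)
  then show ?thesis
    by (simp add: stabilizer_def topspace_group)
qed

text \<open>
  The orbit map is closed: the image of a closed set \<open>C\<close> consists of the points \<open>y\<close> such that
  \<open>g\<inverse> y = z\<close> for some \<open>g \<in> C\<close>, which is the projection along the compact group of a set that is
  closed because \<open>{z}\<close> is.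
\<close>

lemma quotient_map_orbit_map:
  assumes T0: "T0_space X" and z: "z \<in> topspace X"
  shows "quotient_map T (subtopology X (orbit G \<phi> z)) (\<lambda>g. \<phi> g z)"
proof -
  let ?O = "subtopology X (orbit G \<phi> z)"
  have top: "topspace ?O = orbit G \<phi> z"
    using orbit_subset_topspace[OF z] by auto
  show ?thesis
  proof (rule continuous_closed_imp_quotient_map)
    show "continuous_map T ?O (\<lambda>g. \<phi> g z)"
      using continuous_map_orbit_map[OF z]
      by (auto simp: continuous_map_in_subtopology orbit_def topspace_group)
    show "(\<lambda>g. \<phi> g z) ` topspace T = topspace ?O"
      unfolding top by (auto simp: orbit_def topspace_group)
    show "closed_map T ?O (\<lambda>g. \<phi> g z)"
      unfolding closed_map_def
    proof (intro allI impI)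
      fix C assume C: "closedin T C"
      then have CG: "C \<subseteq> carrier G"
        using closedin_subset topspace_group by metis
      let ?P = "prod_topology T ?O"
      let ?f = "\<lambda>p. \<phi> (inv (fst p)) (snd p)"
      have "continuous_map ?P T (\<lambda>p. inv (fst p))"
        using continuous_map_compose[OF continuous_map_fst continuous_inv] by (simp add: o_def)
      moreover have "continuous_map ?P X snd"
        using continuous_map_into_fulltopology[OF continuous_map_snd] .
      ultimately have "continuous_map ?P X ?f"
        by (rule continuous_map_act)
      moreover have "?f p \<in> orbit G \<phi> z" if "p \<in> topspace ?P" for p
        using that act_in_orbit[OF z] group.inv_closed[OF group_G] by (auto simp: topspace_group)
      ultimately have "continuous_map ?P ?O ?f"
        by (auto simp: continuous_map_in_subtopology)
      then have "closedin ?P {p \<in> topspace ?P. ?f p \<in> {z}}"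
        using closedin_orbit_singleton[OF assms] by (rule closedin_continuous_map_preimage)
      moreover have "closedin ?P {p \<in> topspace ?P. fst p \<in> C}"
        using continuous_map_fst C by (rule closedin_continuous_map_preimage)
      ultimately have "closedin ?P ({p \<in> topspace ?P. ?f p \<in> {z}} \<inter> {p \<in> topspace ?P. fst p \<in> C})"
        by (rule closedin_Int)
      then have "closedin ?O
          (snd ` ({p \<in> topspace ?P. ?f p \<in> {z}} \<inter> {p \<in> topspace ?P. fst p \<in> C}))"
        using closed_map_snd[OF compact_group] unfolding closed_map_def by blast
      moreover have "snd ` ({p \<in> topspace ?P. ?f p \<in> {z}} \<inter> {p \<in> topspace ?P. fst p \<in> C})
          = (\<lambda>g. \<phi> g z) ` C" (is "?L = ?R")
      proof
        show "?L \<subseteq> ?R"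
        proof
          fix y assume "y \<in> ?L"
          then obtain g where g: "g \<in> C" "y \<in> topspace X" "\<phi> (inv g) y = z"
            by auto
          moreover from g CG have "inv g \<in> carrier G"
            using group.inv_closed[OF group_G] by auto
          ultimately have "\<phi> (inv (inv g)) z = y"
            using orbit_sym_aux by blast
          moreover have "inv (inv g) = g"
            using g(1) CG group.inv_inv[OF group_G] by auto
          ultimately show "y \<in> ?R"
            using g(1) by auto
        qed
        show "?R \<subseteq> ?L"
        proof
          fix y assume "y \<in> ?R"
          then obtain g where g: "g \<in> C" "y = \<phi> g z"
            by auto
          with CG have "g \<in> carrier G" by auto
          with g z have "(g, y) \<in> {p \<in> topspace ?P. ?f p \<in> {z}} \<inter> {p \<in> topspace ?P. fst p \<in> C}"
            using orbit_sym_aux[of g z y] act_in_topspace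
            by (auto simp: topspace_group orbit_def)
          then show "y \<in> ?L"
            by force
        qed
      qed
      ultimately show "closedin ?O ((\<lambda>g. \<phi> g z) ` C)"
        by simp
    qed
  qed
qed

text \<open>
  The deformation is \<open>(g z, t) \<mapsto> g \<alpha>(t)\<close> for a path \<open>\<alpha>\<close> from \<open>z\<close> to \<open>x0\<close> in the fixed points of the
  stabiliser of \<open>z\<close>: if \<open>g z = h z\<close>, then \<open>h\<inverse> g\<close> fixes \<open>\<alpha>(t)\<close>, so the value depends on \<open>g z\<close> only.
  It is continuous because \<open>(g, t) \<mapsto> g \<alpha>(t)\<close> is and the orbit map is a quotient map.
\<close>

lemma orbit_G_contractible:
  assumes T0: "T0_space X" and conn: "G_connected G T X \<phi>"
    and x0: "x0 \<in> fixed_points X \<phi> (carrier G)" and z: "z \<in> topspace X"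
  shows "G_homotopic G (subtopology X (orbit G \<phi> z)) \<phi> X \<phi> (\<lambda>y. y) (\<lambda>_. x0)"
proof -
  let ?H = "stabilizer G \<phi> z" and ?O = "subtopology X (orbit G \<phi> z)"
  let ?I = "top_of_set {0..1::real}"
  have top: "topspace ?O = orbit G \<phi> z"
    using orbit_subset_topspace[OF z] by auto
  have HG: "?H \<subseteq> carrier G"
    by (auto simp: stabilizer_def)
  have "path_connectedin X (fixed_points X \<phi> ?H)"
    using conn closedin_stabilizer[OF T0 z] stabilizer_subgroup[OF z] by (simp add: G_connected_def)
  moreover have "z \<in> fixed_points X \<phi> ?H" "x0 \<in> fixed_points X \<phi> ?H"
    using z x0 HG by (auto simp: fixed_points_def stabilizer_def)
  ultimately obtain \<alpha> where \<alpha>: "pathin X \<alpha>" "\<alpha> ` {0..1} \<subseteq> fixed_points X \<phi> ?H" "\<alpha> 0 = z" "\<alpha> 1 = x0"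
    unfolding path_connectedin by blast
  have \<alpha>_top: "\<alpha> t \<in> topspace X" if "t \<in> {0..1}" for t
    using subsetD[OF \<alpha>(2) imageI[OF that]] by (simp add: fixed_points_def)
  have well_def: "\<phi> g (\<alpha> t) = \<phi> h (\<alpha> t)"
    if g: "g \<in> carrier G" and h: "h \<in> carrier G" and t: "t \<in> {0..1}" and eq: "\<phi> g z = \<phi> h z" for g h t
  proof -
    have ih: "inv h \<in> carrier G"
      using h group.inv_closed[OF group_G] by blast
    have "\<phi> (inv h \<otimes> g) z = z"
      using composition_rule[OF z ih g] orbit_sym_aux[OF h z refl] eq by simp
    then have "inv h \<otimes> g \<in> ?H"
      using ih g monoid.m_closed[OF group.is_monoid[OF group_G]] by (simp add: stabilizer_def)
    then have "\<phi> (inv h \<otimes> g) (\<alpha> t) = \<alpha> t"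
      using subsetD[OF \<alpha>(2) imageI[OF t]] by (simp add: fixed_points_def)
    then have "\<phi> h (\<phi> (inv h) (\<phi> g (\<alpha> t))) = \<phi> h (\<alpha> t)"
      using composition_rule[OF \<alpha>_top[OF t] ih g] by simp
    moreover have "\<phi> h (\<phi> (inv h) x) = x" if "x \<in> topspace X" for x
      using orbit_sym_aux[OF ih that refl] h group.inv_inv[OF group_G] by simp
    ultimately show ?thesis
      using act_in_topspace[OF g \<alpha>_top[OF t]] by simp
  qed
  \<comment> \<open>The unit interval is locally compact, so its product with the orbit map is again a quotient map.\<close>
  have q: "quotient_map (prod_topology ?I T) (prod_topology ?I ?O) (\<lambda>(t, g). (t, \<phi> g z))"
    by (rule quotient_map_prod_right[OF _ _ quotient_map_orbit_map[OF T0 z]])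
      (simp_all add: Hausdorff_space_subtopology compact_imp_locally_compact_space
        compact_space_subtopology)
  have cont: "continuous_map (prod_topology ?I T) X (\<lambda>(t, g). \<phi> g (\<alpha> t))"
  proof -
    have "continuous_map (prod_topology ?I T) X (\<alpha> \<circ> fst)"
      using \<alpha>(1) unfolding pathin_def by (rule continuous_map_compose[OF continuous_map_fst])
    from continuous_map_act[OF continuous_map_snd this] show ?thesis
      by (simp add: case_prod_unfold)
  qed
  obtain k where k: "continuous_map (prod_topology ?I ?O) X k"
    and k_lift: "\<And>p. p \<in> topspace (prod_topology ?I T) \<Longrightarrow>
      k ((\<lambda>(t, g). (t, \<phi> g z)) p) = (\<lambda>(t, g). \<phi> g (\<alpha> t)) p"
  proof (rule quotient_map_lift_exists[OF q cont])
    fix p p' assume p: "p \<in> topspace (prod_topology ?I T)" "p' \<in> topspace (prod_topology ?I T)"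
      and eq: "(\<lambda>(t, g). (t, \<phi> g z)) p = (\<lambda>(t, g). (t, \<phi> g z)) p'"
    have "\<phi> (snd p) (\<alpha> (fst p)) = \<phi> (snd p') (\<alpha> (fst p))"
      using p eq by (intro well_def) (simp_all add: topspace_group mem_Times_iff case_prod_unfold)
    with eq show "(\<lambda>(t, g). \<phi> g (\<alpha> t)) p = (\<lambda>(t, g). \<phi> g (\<alpha> t)) p'"
      by (simp add: case_prod_unfold)
  qed blast
  have k_eq: "k (t, \<phi> g z) = \<phi> g (\<alpha> t)" if "t \<in> {0..1}" "g \<in> carrier G" for t g
    using that k_lift[of "(t, g)"] by (simp add: topspace_group)
  have k_ends: "k (0, y) = y \<and> k (1, y) = x0" if y: "y \<in> topspace ?O" for y
  proof -
    obtain h where h: "h \<in> carrier G" "y = \<phi> h z"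
      using y[unfolded top] unfolding orbit_def by blast
    moreover have "\<phi> h x0 = x0"
      using x0 h(1) by (simp add: fixed_points_def)
    ultimately show ?thesis
      using k_eq[of 0 h] k_eq[of 1 h] \<alpha>(3,4) by simp
  qed
  have k_equiv: "G_equivariant G (topspace ?O) \<phi> \<phi> (\<lambda>y. k (t, y))" if t: "t \<in> {0..1}" for t
    unfolding G_equivariant_def
  proof (intro ballI)
    fix g y assume g: "g \<in> carrier G" and y: "y \<in> topspace ?O"
    obtain h where h: "h \<in> carrier G" "y = \<phi> h z"
      using y[unfolded top] unfolding orbit_def by blast
    have gh: "g \<otimes> h \<in> carrier G"
      using g h monoid.m_closed[OF group.is_monoid[OF group_G]] by blast
    show "k (t, \<phi> g y) = \<phi> g (k (t, y))"
      using k_eq[OF t gh] k_eq[OF t h(1)] h(2)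
        composition_rule[OF z g h(1)] composition_rule[OF \<alpha>_top[OF t] g h(1)] by simp
  qed
  have cong: "G_equivariant G (topspace ?O) \<phi> \<phi> f \<longleftrightarrow> G_equivariant G (topspace ?O) \<phi> \<phi> f'"
    if "\<And>x. x \<in> topspace ?O \<Longrightarrow> f x = f' x" for f f'
    using that act_in_orbit[OF z] unfolding G_equivariant_def top by simp
  show ?thesis
    unfolding G_homotopic_def
  proof (rule iffD2[OF homotopic_with[OF cong]])
    show "\<exists>k. continuous_map (prod_topology ?I ?O) X k \<and> (\<forall>y\<in>topspace ?O. k (0, y) = y) \<and>
        (\<forall>y\<in>topspace ?O. k (1, y) = x0) \<and>
        (\<forall>t\<in>{0..1}. G_equivariant G (topspace ?O) \<phi> \<phi> (\<lambda>y. k (t, y)))"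
      using k k_ends k_equiv by (intro exI[of _ k]) blast
  qed blast
qed


section \<open>Categorical sets and the axis inclusions\<close>

text \<open>
  One direction is \<open>orbit_G_contractible\<close>; in the other, the constant map has image in the
  one-point orbit of \<open>x\<^sub>0\<close>.
\<close>

lemma G_categorical_iff_contractible_to_fixed_point:
  assumes T0: "T0_space X" and conn: "G_connected G T X \<phi>"
    and x0: "x0 \<in> fixed_points X \<phi> (carrier G)"
    and U: "openin X U" "G_invariant G \<phi> U"
  shows "G_categorical G X \<phi> U \<longleftrightarrow> G_homotopic G (subtopology X U) \<phi> X \<phi> (\<lambda>x. x) (\<lambda>_. x0)"
proof
  have top: "topspace (subtopology X U) = U"
    using openin_subset[OF U(1)] by auto
  assume "G_categorical G X \<phi> U"
  then obtain c z where c: "continuous_map (subtopology X U) X c" "G_equivariant G U \<phi> \<phi> c"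
    and z: "z \<in> topspace X" "c ` U \<subseteq> orbit G \<phi> z"
    and h1: "G_homotopic G (subtopology X U) \<phi> X \<phi> (\<lambda>x. x) c"
    unfolding G_categorical_def G_map_def top by blast
  have "homotopic_with (G_equivariant G U \<phi> \<phi>) (subtopology X U) X ((\<lambda>y. y) \<circ> c) ((\<lambda>_. x0) \<circ> c)"
  proof (rule homotopic_with_compose_continuous_map_right)
    show "homotopic_with (G_equivariant G (orbit G \<phi> z) \<phi> \<phi>) (subtopology X (orbit G \<phi> z)) X
        (\<lambda>y. y) (\<lambda>_. x0)"
      using orbit_G_contractible[OF T0 conn x0 z(1)] orbit_subset_topspace[OF z(1)]
      unfolding G_homotopic_def by (simp add: inf.absorb2)
    show "continuous_map (subtopology X U) (subtopology X (orbit G \<phi> z)) c"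
      using c(1) z(2) top by (auto simp: continuous_map_in_subtopology)
    show "G_equivariant G U \<phi> \<phi> (j \<circ> c)" if "G_equivariant G (orbit G \<phi> z) \<phi> \<phi> j" for j
      using that c(2) z(2) unfolding G_equivariant_def by (simp add: image_subset_iff)
  qed
  then have "homotopic_with (G_equivariant G U \<phi> \<phi>) (subtopology X U) X c (\<lambda>_. x0)"
    by (simp add: o_def)
  with h1 show "G_homotopic G (subtopology X U) \<phi> X \<phi> (\<lambda>x. x) (\<lambda>_. x0)"
    unfolding G_homotopic_def top by (rule homotopic_with_trans)
next
  assume h: "G_homotopic G (subtopology X U) \<phi> X \<phi> (\<lambda>x. x) (\<lambda>_. x0)"
  have x0_top: "x0 \<in> topspace X"
    using x0 by (simp add: fixed_points_def)
  have "G_map G (subtopology X U) \<phi> X \<phi> (\<lambda>_. x0)"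
    using x0 by (simp add: G_map_def G_equivariant_def fixed_points_def)
  moreover have "(\<lambda>_. x0) ` U \<subseteq> orbit G \<phi> x0"
    using orbit_refl[OF x0_top] by auto
  ultimately show "G_categorical G X \<phi> U"
    unfolding G_categorical_def using U h x0_top by blast
qed

lemma contractible_to_fixed_point_iff_axes_G_homotopic:
  assumes x0: "x0 \<in> fixed_points X \<phi> (carrier G)"
    and U: "openin X U"
  shows "G_homotopic G (subtopology X U) \<phi> X \<phi> (\<lambda>x. x) (\<lambda>_. x0) \<longleftrightarrow>
    G_homotopic G (subtopology X U) \<phi> (prod_topology X X) (diagonal_action X \<phi>)
      (\<lambda>x. (x, x0)) (\<lambda>x. (x0, x))"
proof -
  have top: "topspace (subtopology X U) = U"
    using openin_subset[OF U] by auto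
  have x0_top: "x0 \<in> topspace X" and x0_fix: "\<And>g. g \<in> carrier G \<Longrightarrow> \<phi> g x0 = x0"
    using x0 by (auto simp: fixed_points_def)
  let ?E = "G_equivariant G U \<phi> \<phi>" and ?E2 = "G_equivariant G U \<phi> (diagonal_action X \<phi>)"
  let ?S = "subtopology X U" and ?XX = "prod_topology X X"
  show ?thesis
    unfolding G_homotopic_def top
  proof
    assume "homotopic_with ?E ?S X (\<lambda>x. x) (\<lambda>_. x0)"
    \<comment> \<open>Continuity of the intermediate maps is recorded because the diagonal action is the expected
      one only on \<open>topspace X \<times> topspace X\<close>.\<close>
    then have h: "homotopic_with (\<lambda>j. continuous_map ?S X j \<and> ?E j) ?S X (\<lambda>x. x) (\<lambda>_. x0)"
      by (rule homotopic_with_mono) blast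
    have in_top: "j x \<in> topspace X" if "continuous_map ?S X j" "x \<in> U" for j x
      using funcset_mem[OF continuous_map_funspace[OF that(1)]] that(2) unfolding top .
    have "homotopic_with ?E2 ?S ?XX ((\<lambda>x. (x, x0)) \<circ> (\<lambda>x. x)) ((\<lambda>x. (x, x0)) \<circ> (\<lambda>_. x0))"
      by (rule homotopic_with_compose_continuous_map_left[OF h])
        (auto simp: continuous_map_pairedI x0_top x0_fix in_top G_equivariant_def diagonal_action_def)
    moreover
    have "homotopic_with ?E2 ?S ?XX ((\<lambda>x. (x0, x)) \<circ> (\<lambda>x. x)) ((\<lambda>x. (x0, x)) \<circ> (\<lambda>_. x0))"
      by (rule homotopic_with_compose_continuous_map_left[OF h])
        (auto simp: continuous_map_pairedI x0_top x0_fix in_top G_equivariant_def diagonal_action_def)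
    ultimately show "homotopic_with ?E2 ?S ?XX (\<lambda>x. (x, x0)) (\<lambda>x. (x0, x))"
      unfolding o_def by (meson homotopic_with_symD homotopic_with_trans)
  next
    assume "homotopic_with ?E2 ?S ?XX (\<lambda>x. (x, x0)) (\<lambda>x. (x0, x))"
    then have "homotopic_with (\<lambda>j. continuous_map ?S ?XX j \<and> ?E2 j) ?S ?XX
        (\<lambda>x. (x, x0)) (\<lambda>x. (x0, x))"
      by (rule homotopic_with_mono) blast
    then have "homotopic_with ?E ?S X (fst \<circ> (\<lambda>x. (x, x0))) (fst \<circ> (\<lambda>x. (x0, x)))"
    proof (rule homotopic_with_compose_continuous_map_left[OF _ continuous_map_fst])
      fix j assume j: "continuous_map ?S ?XX j \<and> ?E2 j"
      then have "j x \<in> topspace X \<times> topspace X" if "x \<in> U" for x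
        using funcset_mem[OF continuous_map_funspace, of ?S ?XX j x] that unfolding top by simp
      with j show "?E (fst \<circ> j)"
        by (simp add: G_equivariant_def diagonal_action_def)
    qed
    then show "homotopic_with ?E ?S X (\<lambda>x. x) (\<lambda>_. x0)"
      by (simp add: o_def)
  qed
qed

end


section \<open>Equivariant category as a homotopic distance\<close>

lemma compact_Lie_group_action:
  assumes "compact_Lie_group G T n A" "G_space G T X \<phi>"
  shows "compact_group_action G X \<phi> T"
  using assms
  unfolding compact_Lie_group_def Lie_group_def smooth_manifold_map_def G_space_def
    compact_group_action_def compact_group_action_axioms_def by blast

theorem proposition3p6:
  fixes G :: "('g, 'm) monoid_scheme" and T :: "'g topology"
    and n :: nat and A :: "'g chart set"
    and X :: "'x topology" and \<phi> :: "'g \<Rightarrow> 'x \<Rightarrow> 'x"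
    and x0 :: 'x and i1 i2 :: "'x \<Rightarrow> 'x \<times> 'x"
  assumes "compact_Lie_group G T n A"
    and "G_space G T X \<phi>"
    and "T0_space X"
    and "G_connected G T X \<phi>"
    and "x0 \<in> fixed_points X \<phi> (carrier G)"
    and "i1 = (\<lambda>x. (x, x0))"
    and "i2 = (\<lambda>x. (x0, x))"
  shows "cat_G G X \<phi> = D_G G X \<phi> (prod_topology X X) (diagonal_action X \<phi>) i1 i2"
proof -
  interpret compact_group_action G X \<phi> T
    using assms(1,2) by (rule compact_Lie_group_action)
  have "G_categorical G X \<phi> U \<longleftrightarrow>
      openin X U \<and> G_invariant G \<phi> U \<and>
      G_homotopic G (subtopology X U) \<phi> (prod_topology X X) (diagonal_action X \<phi>) i1 i2" for U
  proof (cases "openin X U \<and> G_invariant G \<phi> U")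
    case True
    then show ?thesis
      using G_categorical_iff_contractible_to_fixed_point[OF assms(3,4,5)]
        contractible_to_fixed_point_iff_axes_G_homotopic[OF assms(5)]
      unfolding assms(6,7) by blast
  next
    case False
    then show ?thesis
      by (auto simp: G_categorical_def)
  qed
  then show ?thesis
    unfolding cat_G_def D_G_def by simp
qed

end
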